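(* Let $\{\varphi_n\}_{n=0}^\infty$ be a stationary sequence of unit vectors in a Hilbert space $H$, let $r\in(0,1)$ be fixed, and let $\{\omega_n\}_{n=0}^\infty$ be a sequence of relaxation parameters. For data $\{c_n\}_{n=0}^\infty\subset\mathbb{C}$ consider (A) the augmented Kaczmarz algorithm with parameter $r$: $\vec{x}_{-1}=\vec{y}_{-1}=0$ and, for $n\ge0$, $\vec{x}_n=\vec{x}_{n-1}+(c_n-\langle\vec{x}_{n-1},\varphi_n\rangle)\varphi_n$ and $\vec{y}_n=\vec{y}_{n-1}+r^n\langle\vec{x}_n-\vec{x}_{n-1},\varphi_n\rangle\varphi_n$; (B) the relaxed Kaczmarz algorithm with parameters $\{\omega_n\}$: $\vec{u}_{-1}=0$ and, for $n\ge0$, $\vec{u}_n=\vec{u}_{n-1}+\omega_n(c_n-\langle\vec{u}_{n-1},\varphi_n\rangle)\varphi_n$. Then the two algorithms are equal, i.e. $\vec{y}_N=\vec{u}_N$ for all $N\ge0$ and all data sequences $\{c_n\}$, if and only if $\omega_n=r^n$ for all $n\ge0$ and $\{\varphi_n\}_{n=0}^\infty$ is an orthogonal set (that is, $\langle\varphi_n,\varphi_m\rangle=0$ for $n\ne m$).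
   Context: $H$ is a complex Hilbert space. A sequence $\{\varphi_n\}_{n=0}^\infty\subset H$ is stationary if $\langle\varphi_{n+k},\varphi_{m+k}\rangle=\langle\varphi_n,\varphi_m\rangle$ for all $n,m,k\in\mathbb{N}_0$. *)

theory Defs
  imports "HOL-Analysis.Analysis"
begin

text \<open>
  Complex Hilbert spaces. The inner product is linear in its first argument and
  conjugate-linear in the second.
\<close>

class complex_vector = real_vector +
  fixes scaleC :: "complex \<Rightarrow> 'a \<Rightarrow> 'a"  (infixr \<open>*\<^sub>C\<close> 75)
  assumes scaleC_add_right: "a *\<^sub>C (x + y) = a *\<^sub>C x + a *\<^sub>C y"
    and scaleC_add_left: "(a + b) *\<^sub>C x = a *\<^sub>C x + b *\<^sub>C x"
    and scaleC_scaleC: "a *\<^sub>C b *\<^sub>C x = (a * b) *\<^sub>C x"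
    and scaleC_one: "1 *\<^sub>C x = x"
    and scaleC_of_real: "complex_of_real s *\<^sub>C x = s *\<^sub>R x"

class complex_inner = complex_vector + real_normed_vector +
  fixes cinner :: "'a \<Rightarrow> 'a \<Rightarrow> complex"
  assumes cinner_commute: "cinner x y = cnj (cinner y x)"
    and cinner_add_left: "cinner (x + y) z = cinner x z + cinner y z"
    and cinner_scaleC_left: "cinner (a *\<^sub>C x) y = a * cinner x y"
    and norm_eq_sqrt_cinner: "norm x = sqrt (Re (cinner x x))"

text \<open>
  Positive definiteness is not listed as an axiom: \<open>cinner x x\<close> is real by
  \<open>cinner_commute\<close>, and the norm axioms together with \<open>norm_eq_sqrt_cinner\<close>
  give the rest.
\<close>

lemma cinner_self: "cinner x x = complex_of_real ((norm x)\<^sup>2)"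
  for x :: "'a::complex_inner"
proof -
  have "Im (cinner x x) = 0"
    using arg_cong[OF cinner_commute[of x x], of Im] by simp
  moreover have "0 \<le> sqrt (Re (cinner x x))"
    by (metis norm_eq_sqrt_cinner norm_ge_zero)
  ultimately show ?thesis
    by (simp add: complex_eq_iff norm_eq_sqrt_cinner)
qed

class complex_hilbert_space = complex_inner + complete_space

instantiation complex :: complex_hilbert_space
begin

definition scaleC_complex :: "complex \<Rightarrow> complex \<Rightarrow> complex"
  where "scaleC_complex a x = a * x"

definition cinner_complex :: "complex \<Rightarrow> complex \<Rightarrow> complex"
  where "cinner_complex x y = x * cnj y"

instance
  by standard
    (auto simp: scaleC_complex_def cinner_complex_def algebra_simps scaleR_conv_of_real
      cmod_def power2_eq_square)

end

definition stationary :: "(nat \<Rightarrow> 'a::complex_inner) \<Rightarrow> bool"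
  where "stationary \<phi> \<longleftrightarrow>
    (\<forall>n m k. cinner (\<phi> (n + k)) (\<phi> (m + k)) = cinner (\<phi> n) (\<phi> m))"

text \<open>
  The iterates start at index $-1$, so indices are shifted by one below:
  the value at \<open>0\<close> is the initial vector and the value at \<open>Suc n\<close> is the
  iterate with index \<open>n\<close>.
\<close>

primrec augmented_x :: "(nat \<Rightarrow> 'a::complex_inner) \<Rightarrow> (nat \<Rightarrow> complex) \<Rightarrow> nat \<Rightarrow> 'a"
  where
    "augmented_x \<phi> c 0 = 0"
  | "augmented_x \<phi> c (Suc n) = augmented_x \<phi> c n
       + (c n - cinner (augmented_x \<phi> c n) (\<phi> n)) *\<^sub>C \<phi> n"

primrec augmented_y ::
    "real \<Rightarrow> (nat \<Rightarrow> 'a::complex_inner) \<Rightarrow> (nat \<Rightarrow> complex) \<Rightarrow> nat \<Rightarrow> 'a"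
  where
    "augmented_y r \<phi> c 0 = 0"
  | "augmented_y r \<phi> c (Suc n) = augmented_y r \<phi> c n
       + (complex_of_real (r ^ n)
            * cinner (augmented_x \<phi> c (Suc n) - augmented_x \<phi> c n) (\<phi> n)) *\<^sub>C \<phi> n"

primrec relaxed_u ::
    "(nat \<Rightarrow> complex) \<Rightarrow> (nat \<Rightarrow> 'a::complex_inner) \<Rightarrow> (nat \<Rightarrow> complex) \<Rightarrow> nat \<Rightarrow> 'a"
  where
    "relaxed_u \<omega> \<phi> c 0 = 0"
  | "relaxed_u \<omega> \<phi> c (Suc n) = relaxed_u \<omega> \<phi> c n
       + (\<omega> n * (c n - cinner (relaxed_u \<omega> \<phi> c n) (\<phi> n))) *\<^sub>C \<phi> n"

end

theory Submission
  imports Defs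
begin

text \<open>
  Test the equality of the algorithms on data for which the Kaczmarz iteration stops after one
  step: with \<open>c\<^sub>n = 0\<close> for \<open>n < k\<close>, \<open>c\<^sub>k = 1\<close> and \<open>c\<^sub>n = \<langle>\<phi>\<^sub>k, \<phi>\<^sub>n\<rangle>\<close> for \<open>n > k\<close>, the iterates
  jump from \<open>0\<close> to \<open>\<phi>\<^sub>k\<close> and stay there, so the augmented iterates jump from \<open>0\<close> to \<open>r\<^sup>k \<phi>\<^sub>k\<close>.
  Step \<open>k\<close> of the relaxed algorithm then gives \<open>\<omega>\<^sub>k = r\<^sup>k\<close>, and step \<open>n > k\<close>, which has to be
  stationary as well, gives \<open>r\<^sup>n (1 - r\<^sup>k) \<langle>\<phi>\<^sub>k, \<phi>\<^sub>n\<rangle> = 0\<close>. This is vacuous for \<open>k = 0\<close>, but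
  stationarity shifts the pair \<open>(k, n)\<close> to \<open>(k + 1, n + 1)\<close>. Conversely, for an orthogonal
  sequence both algorithms produce the partial sums of \<open>\<Sum>n. r\<^sup>n c\<^sub>n \<phi>\<^sub>n\<close>.
\<close>

lemma scaleC_zero_left [simp]: "0 *\<^sub>C x = 0"
  using scaleC_of_real[of 0 x] by simp

lemma cinner_zero_left [simp]: "cinner 0 y = 0"
  using cinner_add_left[of 0 0 y] by simp

lemma cinner_unit_self:
  fixes x :: "'a::complex_inner"
  assumes "norm x = 1"
  shows "cinner x x = 1"
  using assms by (simp add: cinner_self)

lemma scaleC_unit_cancel:
  fixes x :: "'a::complex_inner"
  assumes "norm x = 1" and "a *\<^sub>C x = b *\<^sub>C x"
  shows "a = b"
  using arg_cong[OF assms(2), of "\<lambda>v. cinner v x"]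
  by (simp add: cinner_scaleC_left cinner_unit_self assms(1))

text \<open>The index \<open>n = k\<close> needs no clause of its own: a unit vector gives the value
  1 there.\<close>

definition frozen_data :: "(nat \<Rightarrow> 'a::complex_inner) \<Rightarrow> nat \<Rightarrow> nat \<Rightarrow> complex"
  where "frozen_data \<phi> k n = (if n < k then 0 else cinner (\<phi> k) (\<phi> n))"

lemma augmented_x_frozen_data:
  assumes "norm (\<phi> k) = 1"
  shows "augmented_x \<phi> (frozen_data \<phi> k) n = (if n \<le> k then 0 else \<phi> k)"
proof (induction n)
  case (Suc n)
  then show ?case
    using assms
    by (cases n k rule: linorder_cases)
      (auto simp: frozen_data_def cinner_unit_self scaleC_one)
qed simp

lemma augmented_y_frozen_data:
  assumes "norm (\<phi> k) = 1"
  shows "augmented_y r \<phi> (frozen_data \<phi> k) n =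
    (if n \<le> k then 0 else complex_of_real (r ^ k) *\<^sub>C \<phi> k)"
proof (induction n)
  case (Suc n)
  then show ?case
    using assms
    by (cases n k rule: linorder_cases)
      (auto simp: augmented_x_frozen_data cinner_unit_self
        simp del: augmented_x.simps of_real_power)
qed simp

text \<open>By the index shift, the iterate at \<open>n\<close> is a combination of the
  \<open>\<phi> i\<close> with \<open>i < n\<close>, so \<open>n = m\<close> is allowed.\<close>

lemma augmented_x_orthogonal:
  assumes "\<And>n m. n \<noteq> m \<Longrightarrow> cinner (\<phi> n) (\<phi> m) = 0" and "n \<le> m"
  shows "cinner (augmented_x \<phi> c n) (\<phi> m) = 0"
  using assms(2) by (induction n) (auto simp: cinner_add_left cinner_scaleC_left assms(1))

lemma relaxed_u_orthogonal:
  assumes "\<And>n m. n \<noteq> m \<Longrightarrow> cinner (\<phi> n) (\<phi> m) = 0" and "n \<le> m"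
  shows "cinner (relaxed_u \<omega> \<phi> c n) (\<phi> m) = 0"
  using assms(2) by (induction n) (auto simp: cinner_add_left cinner_scaleC_left assms(1))

lemma augmented_y_eq_relaxed_u:
  assumes "\<And>n m. n \<noteq> m \<Longrightarrow> cinner (\<phi> n) (\<phi> m) = 0"
    and "\<And>n. norm (\<phi> n) = 1"
  shows "augmented_y r \<phi> c n = relaxed_u (\<lambda>n. complex_of_real (r ^ n)) \<phi> c n"
  by (induction n)
    (simp_all add: augmented_x_orthogonal relaxed_u_orthogonal cinner_scaleC_left
      cinner_unit_self assms)

theorem proposition7:
  fixes \<phi> :: "nat \<Rightarrow> 'a::complex_hilbert_space"
    and r :: real
    and \<omega> :: "nat \<Rightarrow> complex"
  assumes "stationary \<phi>"
    and "\<And>n. norm (\<phi> n) = 1"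
    and "0 < r" and "r < 1"
  shows "(\<forall>(c :: nat \<Rightarrow> complex) N. augmented_y r \<phi> c (Suc N) = relaxed_u \<omega> \<phi> c (Suc N)) \<longleftrightarrow>
    (\<forall>n. \<omega> n = complex_of_real (r ^ n)) \<and>
    (\<forall>n m. n \<noteq> m \<longrightarrow> cinner (\<phi> n) (\<phi> m) = 0)"
    (is "?equal \<longleftrightarrow> ?powers \<and> ?orthogonal")
proof
  assume ?equal
  have u_frozen: "relaxed_u \<omega> \<phi> (frozen_data \<phi> k) n =
      (if n \<le> k then 0 else complex_of_real (r ^ k) *\<^sub>C \<phi> k)" for k n
  proof (cases n)
    case (Suc N)
    then show ?thesis
      using \<open>?equal\<close> augmented_y_frozen_data[of \<phi> k r n] assms(2) by metis
  qed simp
  have powers: "\<omega> k = complex_of_real (r ^ k)" for k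
  proof -
    have "\<omega> k *\<^sub>C \<phi> k = relaxed_u \<omega> \<phi> (frozen_data \<phi> k) (Suc k)"
      by (simp add: u_frozen[of k k] frozen_data_def cinner_unit_self assms(2))
    also have "\<dots> = complex_of_real (r ^ k) *\<^sub>C \<phi> k"
      by (subst u_frozen) simp
    finally show ?thesis
      by (rule scaleC_unit_cancel[OF assms(2)])
  qed
  have later: "cinner (\<phi> k) (\<phi> n) = 0" if "0 < k" "k < n" for k n
  proof -
    \<comment> \<open>The relaxation parameter times the residual: the datum
      \<open>cinner (\<phi> k) (\<phi> n)\<close> minus \<open>r ^ k\<close> times itself, as the
      iterate is \<open>r ^ k\<close> times \<open>\<phi> k\<close>.\<close>
    let ?d = "\<omega> n * (1 - complex_of_real (r ^ k)) * cinner (\<phi> k) (\<phi> n)"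
    have "relaxed_u \<omega> \<phi> (frozen_data \<phi> k) (Suc n) =
        relaxed_u \<omega> \<phi> (frozen_data \<phi> k) n + ?d *\<^sub>C \<phi> n"
      using that
      by (simp add: u_frozen[of k n] frozen_data_def cinner_scaleC_left algebra_simps)
    then have "?d *\<^sub>C \<phi> n = 0 *\<^sub>C \<phi> n"
      using that by (simp add: u_frozen del: relaxed_u.simps)
    then have "?d = 0"
      by (rule scaleC_unit_cancel[OF assms(2)])
    moreover have "r ^ k \<noteq> 1"
      using that assms(3,4) power_less_one_iff[of r k] by simp
    then have "1 - complex_of_real (r ^ k) \<noteq> 0"
      by (simp del: of_real_power)
    moreover have "\<omega> n \<noteq> 0"
      using assms(3) by (simp add: powers)
    ultimately show ?thesis by simp
  qed
  have less: "cinner (\<phi> k) (\<phi> n) = 0" if "k < n" for k n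
  proof -
    have "cinner (\<phi> (k + 1)) (\<phi> (n + 1)) = cinner (\<phi> k) (\<phi> n)"
      using assms(1) unfolding stationary_def by blast
    then show ?thesis
      using later[of "k + 1" "n + 1"] that by simp
  qed
  then have "cinner (\<phi> n) (\<phi> m) = 0" if "n \<noteq> m" for n m
    using that by (metis cinner_commute complex_cnj_zero linorder_neqE_nat)
  with powers show "?powers \<and> ?orthogonal" by blast
next
  assume "?powers \<and> ?orthogonal"
  then have "\<omega> = (\<lambda>n. complex_of_real (r ^ n))"
    and "\<And>n m. n \<noteq> m \<Longrightarrow> cinner (\<phi> n) (\<phi> m) = 0"
    by auto
  then show ?equal
    using augmented_y_eq_relaxed_u[of \<phi>] assms(2) by blast
qed

end
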